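(* Fix $\gamma>1$. Given initial data $(A(0),A'(0))\in \mathrm{GL}^+(3,\mathbb{R})\times\mathbb{M}^3$, let $A\in C(\mathbb{R},\mathrm{GL}^+(3,\mathbb{R}))\cap C^\infty(\mathbb{R},\mathbb{M}^3)$ be the (unique) global solution of $$A''(t)=(\det A(t))^{1-\gamma}A(t)^{-\top}$$ with these initial data. Let $B=\{y\in\mathbb{R}^3:|y|<1\}$, $\Omega_t=A(t)B$ and $\mathcal{C}=\{(t,x):t\in\mathbb{R},\ x\in\Omega_t\}$. Let $\rho_0\in\mathcal{Y}$ satisfy $0<\lim_{s\to1^-}(1-s)^{-\delta}\rho_0(s)<\infty$ for some $\delta>0$, and let $\varepsilon_0\in\mathcal{Y}$ be defined by $$\varepsilon_0(s)=\frac{\int_s^1\varsigma\rho_0(\varsigma)\,d\varsigma}{(\gamma-1)\rho_0(s)}\quad(0\le s<1),\qquad \varepsilon_0(1)=0.$$ Then the triple $$u(t,x)=A'(t)A(t)^{-1}x,\qquad \rho(t,x)=\frac{\rho_0(|A(t)^{-1}x|)}{\det A(t)},\qquad \varepsilon(t,x)=\frac{\varepsilon_0(|A(t)^{-1}x|)}{(\det A(t))^{\gamma-1}}$$ lies in $C^0(\overline{\mathcal{C}})\cap C^1(\mathcal{C})$, solves the compressible Euler equations $$\rho D_tu+\nabla p=0,\quad D_t\rho+\rho\nabla\cdot u=0,\quad D_t\varepsilon+(\gamma-1)\varepsilon\nabla\cdot u=0,\quad p=(\gamma-1)\rho\varepsilon$$ in $\mathcal{C}$, and satisfies, on the lateral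 boundary $\mathcal{B}=\{(t,x):t\in\mathbb{R},\ x\in\partial\Omega_t\}$, the boundary conditions $$\eta(t,x)\cdot(1,u(t,x))=0,\qquad p(t,x)=0,\qquad D_n\varepsilon(t,x)<0 .$$
   Context: $\mathbb{M}^3$ is the space of real $3\times3$ matrices, $\mathrm{GL}^+(3,\mathbb{R})=\{A\in\mathbb{M}^3:\det A>0\}$, and $A^{-\top}=(A^{-1})^\top$. $\mathcal{Y}=\{f\in C^0[0,1]\cap C^1[0,1): f(s)>0 \text{ for } s\in[0,1),\ f'(0)=f(1)=0\}$. $D_t=\partial_t+u\cdot\nabla$ is the material derivative ($\nabla$ is the gradient in $x$). $\eta=(\eta_t,\eta_x)\in\mathbb{R}\times\mathbb{R}^3$ denotes a normal to $\mathcal{B}$. $D_n\varepsilon(t,x)$, $x\in\partial\Omega_t$, is the spatial derivative of $\varepsilon(t,\cdot)$ at $x$ in the direction of the unit outward normal $n$ to $\partial\Omega_t$, understood as the one-sided derivative $\lim_{h\to0^+}h^{-1}[\varepsilon(t,x)-\varepsilon(t,x-hn)]$. It is known that the ODE has a unique global solution for all such initial data, and that $\varepsilon_0\in\mathcal{Y}$. *)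

theory Defs
  imports "HOL-Analysis.Analysis"
begin

section \<open>Matrix curves and profiles\<close>

definition GL3_plus :: "(real^3^3) set" where
  "GL3_plus = {M. det M > 0}"

definition smooth_curve :: "(real \<Rightarrow> 'a::real_normed_vector) \<Rightarrow> bool" where
  "smooth_curve f \<longleftrightarrow>
     (\<exists>D :: nat \<Rightarrow> real \<Rightarrow> 'a. D 0 = f \<and>
        (\<forall>k t. (D k has_vector_derivative D (Suc k) t) (at t)))"

definition curve_deriv :: "(real \<Rightarrow> 'a::real_normed_vector) \<Rightarrow> real \<Rightarrow> 'a" where
  "curve_deriv f t = vector_derivative f (at t)"

definition global_affine_solution ::
    "real \<Rightarrow> real^3^3 \<Rightarrow> real^3^3 \<Rightarrow> (real \<Rightarrow> real^3^3) \<Rightarrow> bool" where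
  "global_affine_solution \<gamma> A0 A1 A \<longleftrightarrow>
     smooth_curve A \<and> (\<forall>t. A t \<in> GL3_plus) \<and>
     A 0 = A0 \<and> curve_deriv A 0 = A1 \<and>
     (\<forall>t. curve_deriv (curve_deriv A) t =
            det (A t) powr (1 - \<gamma>) *\<^sub>R transpose (matrix_inv (A t)))"

text \<open>
  The class of profiles on the unit interval. Values outside the interval are irrelevant;
  the derivative at 0 is the one-sided one.
\<close>

definition profiles :: "(real \<Rightarrow> real) set" where
  "profiles = {f. continuous_on {0..1} f \<and>
     (\<exists>f'. (\<forall>s\<in>{0..<1}. (f has_real_derivative f' s) (at s within {0..<1})) \<and>
           continuous_on {0..<1} f' \<and> f' 0 = 0) \<and>
     (\<forall>s\<in>{0..<1}. f s > 0) \<and> f 1 = 0}"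

section \<open>The moving domain\<close>

definition domain_at :: "(real \<Rightarrow> real^3^3) \<Rightarrow> real \<Rightarrow> (real^3) set" where
  "domain_at A t = (\<lambda>y. A t *v y) ` ball 0 1"

definition spacetime :: "(real \<Rightarrow> real^3^3) \<Rightarrow> (real \<times> (real^3)) set" where
  "spacetime A = {(t, x). x \<in> domain_at A t}"

definition lateral_boundary :: "(real \<Rightarrow> real^3^3) \<Rightarrow> (real \<times> (real^3)) set" where
  "lateral_boundary A = {(t, x). x \<in> frontier (domain_at A t)}"

section \<open>Differential operators\<close>

definition C1_on :: "'a::real_normed_vector set \<Rightarrow> ('a \<Rightarrow> 'b::real_normed_vector) \<Rightarrow> bool" where
  "C1_on S f \<longleftrightarrow>
     (\<exists>f' :: 'a \<Rightarrow> 'a \<Rightarrow>\<^sub>L 'b.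
        (\<forall>z\<in>S. (f has_derivative blinfun_apply (f' z)) (at z)) \<and> continuous_on S f')"

definition dt :: "(real \<Rightarrow> real^3 \<Rightarrow> 'a::real_normed_vector) \<Rightarrow> real \<Rightarrow> real^3 \<Rightarrow> 'a" where
  "dt f t x = vector_derivative (\<lambda>s. f s x) (at t)"

definition dx :: "3 \<Rightarrow> (real \<Rightarrow> real^3 \<Rightarrow> 'a::real_normed_vector) \<Rightarrow> real \<Rightarrow> real^3 \<Rightarrow> 'a" where
  "dx i f t x = vector_derivative (\<lambda>h. f t (x + h *\<^sub>R axis i 1)) (at 0)"

definition grad :: "(real \<Rightarrow> real^3 \<Rightarrow> real) \<Rightarrow> real \<Rightarrow> real^3 \<Rightarrow> real^3" where
  "grad f t x = (\<chi> i. dx i f t x)"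

definition divergence :: "(real \<Rightarrow> real^3 \<Rightarrow> real^3) \<Rightarrow> real \<Rightarrow> real^3 \<Rightarrow> real" where
  "divergence v t x = (\<Sum>i\<in>UNIV. dx i (\<lambda>s y. v s y $ i) t x)"

definition material_deriv ::
    "(real \<Rightarrow> real^3 \<Rightarrow> real^3) \<Rightarrow> (real \<Rightarrow> real^3 \<Rightarrow> 'a::real_normed_vector)
      \<Rightarrow> real \<Rightarrow> real^3 \<Rightarrow> 'a" where
  "material_deriv u f t x = dt f t x + (\<Sum>i\<in>UNIV. (u t x $ i) *\<^sub>R dx i f t x)"

definition euler_equations_on ::
    "(real \<times> (real^3)) set \<Rightarrow> real \<Rightarrow> (real \<Rightarrow> real^3 \<Rightarrow> real^3) \<Rightarrow> (real \<Rightarrow> real^3 \<Rightarrow> real)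
      \<Rightarrow> (real \<Rightarrow> real^3 \<Rightarrow> real) \<Rightarrow> (real \<Rightarrow> real^3 \<Rightarrow> real) \<Rightarrow> bool" where
  "euler_equations_on S \<gamma> u \<rho> \<epsilon> p \<longleftrightarrow>
     (\<forall>(t, x)\<in>S.
        \<rho> t x *\<^sub>R material_deriv u u t x + grad p t x = 0 \<and>
        material_deriv u \<rho> t x + \<rho> t x * divergence u t x = 0 \<and>
        material_deriv u \<epsilon> t x + (\<gamma> - 1) * \<epsilon> t x * divergence u t x = 0 \<and>
        p t x = (\<gamma> - 1) * \<rho> t x * \<epsilon> t x)"

section \<open>Normals\<close>

definition tangent_vectors :: "'a::real_inner set \<Rightarrow> 'a \<Rightarrow> 'a set" where
  "tangent_vectors M z =
     {v. \<exists>e>0. \<exists>c. c C1_differentiable_on {-e<..<e} \<and> (\<forall>s\<in>{-e<..<e}. c s \<in> M) \<and>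
           c 0 = z \<and> (c has_vector_derivative v) (at 0)}"

definition is_normal :: "'a::real_inner set \<Rightarrow> 'a \<Rightarrow> 'a \<Rightarrow> bool" where
  "is_normal M z \<eta> \<longleftrightarrow> \<eta> \<noteq> 0 \<and> (\<forall>v\<in>tangent_vectors M z. \<eta> \<bullet> v = 0)"

definition outward_unit_normal :: "'a::real_inner set \<Rightarrow> 'a \<Rightarrow> 'a" where
  "outward_unit_normal S x =
     (THE n. norm n = 1 \<and> is_normal (frontier S) x n \<and>
        (\<forall>\<^sub>F h in at_right 0. x - h *\<^sub>R n \<in> S \<and> x + h *\<^sub>R n \<notin> closure S))"

definition has_normal_derivative ::
    "('a::real_inner \<Rightarrow> real) \<Rightarrow> real \<Rightarrow> 'a set \<Rightarrow> 'a \<Rightarrow> bool" where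
  "has_normal_derivative f d S x \<longleftrightarrow>
     ((\<lambda>h. (f x - f (x - h *\<^sub>R outward_unit_normal S x)) / h) \<longlongrightarrow> d) (at_right 0)"

end

theory Submission
  imports Defs
begin

text \<open>
  The flow map of the velocity field is \<open>z \<mapsto> A(t) A(0)\<^sup>-\<^sup>1 z\<close>, so the Lagrangian label of a fluid particle
  may be taken to be \<open>y = A(t)\<^sup>-\<^sup>1 x\<close>, and this label is constant along trajectories
  (\<open>label_deriv\<close>). A field of the form \<open>h(t) g(\<bar>y\<bar>)\<close> therefore has the material derivative
  \<open>h'(t) g(\<bar>y\<bar>)\<close> (\<open>material_deriv_transported\<close>). With \<open>M = A' A\<^sup>-\<^sup>1\<close>, the divergence of \<open>u = M x\<close> is
  \<open>trace M\<close>, which by Jacobi's formula (\<open>has_real_derivative_det\<close>) is the logarithmic derivative of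
  \<open>det A\<close>. Hence the powers of \<open>det A\<close> in the density and in the internal energy are exactly those
  that solve the two scalar equations, whatever the profiles are.

  For the momentum equation, \<open>D\<^sub>t u = A'' A\<^sup>-\<^sup>1 x = (det A)\<^bsup>1-\<gamma>\<^esup> A\<^sup>-\<^sup>\<top> y\<close>. The energy profile is
  chosen so that the pressure profile \<open>(\<gamma> - 1) \<rho>\<^sub>0 \<epsilon>\<^sub>0\<close> equals the integral of \<open>\<sigma> \<rho>\<^sub>0(\<sigma>)\<close> from \<open>s\<close> to
  \<open>1\<close>, whose derivative is \<open>- s \<rho>\<^sub>0(s)\<close>. Hence \<open>\<nabla>p = - (det A)\<^bsup>-\<gamma>\<^esup> \<rho>\<^sub>0(\<bar>y\<bar>) A\<^sup>-\<^sup>\<top> y\<close>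
  (\<open>grad_transported\<close>), which cancels \<open>\<rho> D\<^sub>t u\<close>. Continuous differentiability in space-time is delicate
  only where \<open>y = 0\<close>, because the norm is not smooth there; the condition that profiles have zero slope
  at \<open>0\<close> settles it (\<open>has_derivative_radial\<close>, \<open>continuous_on_radial_gradient\<close>).

  At the boundary, \<open>s \<mapsto> (t + s, A(t + s) y)\<close> is a curve in the lateral boundary with velocity
  \<open>(1, u)\<close>, so every normal is orthogonal to \<open>(1, u)\<close> (\<open>flow_tangent\<close>). By l'Hopital's rule the growth
  condition on \<open>\<rho>\<^sub>0\<close> gives the finite positive limit \<open>1 / ((\<gamma> - 1) (\<delta> + 1))\<close> of \<open>\<epsilon>\<^sub>0(s) / (1 - s)\<close>
  (\<open>energy_profile_slope\<close>). The outward unit normal of the ellipsoid at \<open>x\<close> is the normalised \<open>A\<^sup>-\<^sup>\<top> y\<close>, and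
  along it \<open>\<bar>y\<bar>\<close> has the positive derivative \<open>\<bar>A\<^sup>-\<^sup>\<top> y\<bar>\<close>; the normal derivative of the energy is the
  negative of a product of positive numbers (\<open>has_normal_derivative_ellipsoid\<close>).
\<close>

section \<open>Calculus of matrix curves\<close>

lemma bounded_bilinear_matrix_matrix_mult:
  "bounded_bilinear ((**) :: real^'n^'m \<Rightarrow> real^'p^'n \<Rightarrow> real^'p^'m)"
  unfolding bilinear_conv_bounded_bilinear[symmetric] bilinear_def linear_iff
  by (auto simp: matrix_matrix_mult_def vec_eq_iff sum.distrib algebra_simps sum_distrib_left)

lemma bounded_bilinear_matrix_vector_mult:
  "bounded_bilinear ((*v) :: real^'n^'m \<Rightarrow> real^'n \<Rightarrow> real^'m)"
  unfolding bilinear_conv_bounded_bilinear[symmetric] bilinear_def linear_iff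
  by (auto simp: matrix_vector_mult_def vec_eq_iff sum.distrib algebra_simps sum_distrib_left)

lemmas continuous_on_matrix_matrix_mult =
  bounded_bilinear.continuous_on[OF bounded_bilinear_matrix_matrix_mult]

lemmas continuous_on_matrix_vector_mult =
  bounded_bilinear.continuous_on[OF bounded_bilinear_matrix_vector_mult]

lemma continuous_on_det:
  fixes f :: "'a::topological_space \<Rightarrow> real^'n^'n"
  assumes "continuous_on S f"
  shows "continuous_on S (\<lambda>x. det (f x))"
  unfolding det_def by (intro continuous_intros assms)

lemma
  fixes M :: "real^'n^'n"
  assumes "det M \<noteq> 0"
  shows matrix_inv_right: "M ** matrix_inv M = mat 1"
    and matrix_inv_left: "matrix_inv M ** M = mat 1"
proof -
  have "\<exists>N. M ** N = mat 1 \<and> N ** M = mat 1"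
    using assms invertible_det_nz invertible_def by blast
  then have "M ** matrix_inv M = mat 1 \<and> matrix_inv M ** M = mat 1"
    unfolding matrix_inv_def by (rule someI_ex)
  then show "M ** matrix_inv M = mat 1" "matrix_inv M ** M = mat 1" by auto
qed

text \<open>
  Cramer's rule expresses the entries of the inverse as quotients of polynomials in the entries of the
  matrix, which is how continuity of the inverse is obtained.
\<close>

lemma matrix_inv_entry:
  fixes M :: "real^'n^'n"
  assumes "det M \<noteq> 0"
  shows "matrix_inv M $ k $ l =
    det (\<chi> i j. if j = k then (axis l 1 :: real^'n) $ i else M $ i $ j) / det M"
proof -
  have "M *v (matrix_inv M *v axis l 1) = axis l 1"
    by (simp add: matrix_vector_mul_assoc matrix_inv_right[OF assms])
  then have "(matrix_inv M *v axis l 1) $ k =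
      det (\<chi> i j. if j = k then (axis l 1 :: real^'n) $ i else M $ i $ j) / det M"
    unfolding cramer[OF assms] by (metis (no_types, lifting) vec_lambda_beta)
  then show ?thesis
    by (simp add: matrix_vector_mult_basis column_def)
qed

lemma continuous_on_matrix_inv:
  fixes f :: "'a::topological_space \<Rightarrow> real^'n^'n"
  assumes f: "continuous_on S f" and nz: "\<And>x. x \<in> S \<Longrightarrow> det (f x) \<noteq> 0"
  shows "continuous_on S (\<lambda>x. matrix_inv (f x))"
proof -
  have "continuous_on S (\<lambda>x. det (\<chi> i j. if j = k then (axis l 1 :: real^'n) $ i else f x $ i $ j)
      / det (f x))" for k l
  proof (intro continuous_on_divide continuous_on_det f ballI nz)
    show "continuous_on S (\<lambda>x. \<chi> i j. if j = k then (axis l 1 :: real^'n) $ i else f x $ i $ j)"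
    proof (intro continuous_on_vec_lambda)
      fix i j
      show "continuous_on S (\<lambda>x. if j = k then (axis l 1 :: real^'n) $ i else f x $ i $ j)"
        by (cases "j = k") (auto intro!: continuous_intros f)
    qed
  qed
  then have "continuous_on S (\<lambda>x. \<chi> k l. matrix_inv (f x) $ k $ l)"
    by (intro continuous_on_vec_lambda) (simp add: matrix_inv_entry nz)
  then show ?thesis by simp
qed

lemma has_vector_derivative_iff_slope:
  "(f has_vector_derivative D) (at x) \<longleftrightarrow> ((\<lambda>y. (f y - f x) /\<^sub>R (y - x)) \<longlongrightarrow> D) (at x)"
proof -
  have "norm (f y - f x - (y - x) *\<^sub>R D) / norm (y - x) = norm ((f y - f x) /\<^sub>R (y - x) - D)"
    if "y \<noteq> x" for y
  proof -
    have "f y - f x - (y - x) *\<^sub>R D = (y - x) *\<^sub>R ((f y - f x) /\<^sub>R (y - x) - D)"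
      using that by (simp add: scaleR_diff_right)
    then show ?thesis using that by (metis eq_iff_diff_eq_0 nonzero_mult_div_cancel_left norm_eq_zero norm_scaleR real_norm_def)
  qed
  then have "(f has_vector_derivative D) (at x) \<longleftrightarrow>
      ((\<lambda>y. norm ((f y - f x) /\<^sub>R (y - x) - D)) \<longlongrightarrow> 0) (at x)"
    by (auto simp: has_vector_derivative_def has_derivative_iff_norm bounded_linear_scaleR_left
        eventually_at_filter intro!: tendsto_cong)
  also have "\<dots> \<longleftrightarrow> ((\<lambda>y. (f y - f x) /\<^sub>R (y - x)) \<longlongrightarrow> D) (at x)"
    by (simp add: tendsto_norm_zero_iff LIM_zero_iff)
  finally show ?thesis .
qed

text \<open>
  With \<open>B\<close> the inverse, \<open>B s - B t = - B s (A s - A t) B t\<close>. Dividing by \<open>s - t\<close>, the right-hand side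
  converges because \<open>B\<close> is continuous, and its limit is the derivative.
\<close>

lemma has_vector_derivative_matrix_inv:
  fixes A :: "real \<Rightarrow> real^'n^'n"
  assumes A: "(A has_vector_derivative A') (at t)"
    and cont: "continuous_on UNIV A" and nz: "\<And>s. det (A s) \<noteq> 0"
  shows "((\<lambda>s. matrix_inv (A s)) has_vector_derivative
           - (matrix_inv (A t) ** A' ** matrix_inv (A t))) (at t)"
proof -
  interpret mm: bounded_bilinear "(**) :: real^'n^'n \<Rightarrow> real^'n^'n \<Rightarrow> real^'n^'n"
    by (rule bounded_bilinear_matrix_matrix_mult)
  define B where "B s = matrix_inv (A s)" for s
  have AB: "A s ** B s = mat 1" "B s ** A s = mat 1" for s
    by (simp_all add: B_def matrix_inv_right matrix_inv_left nz)
  have diff: "B s - B t = - (B s ** (A s - A t) ** B t)" for s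
    by (simp add: mm.diff_left mm.diff_right AB flip: matrix_mul_assoc)
  have "continuous_on UNIV B"
    unfolding B_def by (rule continuous_on_matrix_inv[OF cont nz])
  then have B: "(B \<longlongrightarrow> B t) (at t)"
    by (simp add: continuous_on_def)
  have "((\<lambda>s. (A s - A t) /\<^sub>R (s - t)) \<longlongrightarrow> A') (at t)"
    using A by (simp add: has_vector_derivative_iff_slope)
  then have "((\<lambda>s. - (B s ** ((A s - A t) /\<^sub>R (s - t)) ** B t)) \<longlongrightarrow> - (B t ** A' ** B t)) (at t)"
    by (intro tendsto_minus mm.tendsto B tendsto_const)
  then have "((\<lambda>s. (B s - B t) /\<^sub>R (s - t)) \<longlongrightarrow> - (B t ** A' ** B t)) (at t)"
    by (simp add: diff mm.scaleR_right mm.scaleR_left)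
  then have "(B has_vector_derivative - (B t ** A' ** B t)) (at t)"
    by (simp add: has_vector_derivative_iff_slope)
  then show ?thesis by (simp add: B_def[abs_def])
qed

text \<open>
  Jacobi's formula. Writing the derivative of \<open>A\<close> as a multiple \<open>M A\<close> turns it into a polynomial
  identity in the entries of \<open>M\<close> and \<open>A\<close>; here \<open>M\<close> will be the velocity gradient.
\<close>

lemma has_real_derivative_det:
  fixes A M :: "real \<Rightarrow> real^3^3"
  assumes "(A has_vector_derivative M t ** A t) (at t)"
  shows "((\<lambda>s. det (A s)) has_real_derivative trace (M t) * det (A t)) (at t)"
proof -
  have e: "((\<lambda>s. A s $ i $ j) has_real_derivative (\<Sum>k\<in>UNIV. M t $ i $ k * A t $ k $ j)) (at t)" for i j
  proof -
    have "((\<lambda>s. A s $ i $ j) has_vector_derivative (M t ** A t) $ i $ j) (at t)"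
      by (intro bounded_linear.has_vector_derivative[OF bounded_linear_vec_nth] assms)
    then show ?thesis
      by (simp add: has_real_derivative_iff_has_vector_derivative matrix_matrix_mult_def)
  qed
  show ?thesis
    unfolding det_3 trace_def sum_3
    by (rule derivative_eq_intros e refl)+ (simp add: sum_3 algebra_simps)
qed

section \<open>Differential operators from total derivatives\<close>

text \<open>
  In finite dimension, continuity of the derivative in operator norm follows from its continuity in each
  fixed direction.
\<close>

lemma C1_onI:
  fixes f :: "'a::euclidean_space \<Rightarrow> 'b::real_normed_vector"
  assumes der: "\<And>z. z \<in> S \<Longrightarrow> (f has_derivative F z) (at z)"
    and cont: "\<And>v. continuous_on S (\<lambda>z. F z v)"
  shows "C1_on S f"
proof -
  have bl: "bounded_linear (F z)" if "z \<in> S" for z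
    using der[OF that] by (rule has_derivative_bounded_linear)
  have *: "blinfun_apply (Blinfun (F z)) = F z" if "z \<in> S" for z
    using bl[OF that] by (rule bounded_linear_Blinfun_apply)
  have "continuous_on S (\<lambda>z. Blinfun (F z))"
  proof (rule continuous_on_blinfun_componentwise)
    fix i :: 'a
    show "continuous_on S (\<lambda>z. blinfun_apply (Blinfun (F z)) i)"
      using cont[of i] by (rule continuous_on_eq) (simp add: *)
  qed
  then show ?thesis
    unfolding C1_on_def using der by (intro exI[of _ "\<lambda>z. Blinfun (F z)"]) (auto simp: *)
qed

lemma dt_eq:
  assumes "((\<lambda>(t, x). f t x) has_derivative F) (at (t, x))"
  shows "dt f t x = F (1, 0)"
proof -
  have "((\<lambda>s. (s, x)) has_vector_derivative (1, 0)) (at t)"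
    by (auto intro!: derivative_eq_intros)
  then have "(((\<lambda>(t, x). f t x) \<circ> (\<lambda>s. (s, x))) has_vector_derivative F (1, 0)) (at t)"
    by (rule vector_derivative_diff_chain_within[where S = UNIV and f = "\<lambda>s. (s, x)", simplified])
       (use assms in \<open>auto intro: has_derivative_at_withinI\<close>)
  then show ?thesis
    by (simp add: dt_def o_def vector_derivative_at)
qed

lemma dx_eq:
  assumes "((\<lambda>(t, x). f t x) has_derivative F) (at (t, x))"
  shows "dx i f t x = F (0, axis i 1)"
proof -
  have "((\<lambda>h. (t, x + h *\<^sub>R axis i 1)) has_vector_derivative (0, axis i 1)) (at 0)"
    by (auto intro!: derivative_eq_intros)
  then have "(((\<lambda>(t, x). f t x) \<circ> (\<lambda>h. (t, x + h *\<^sub>R axis i 1))) has_vector_derivative F (0, axis i 1)) (at 0)"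
    by (rule vector_derivative_diff_chain_within[where S = UNIV and f = "\<lambda>h. (t, x + h *\<^sub>R axis i 1)", simplified])
       (use assms in \<open>auto intro: has_derivative_at_withinI\<close>)
  then show ?thesis
    by (simp add: dx_def o_def vector_derivative_at)
qed

lemma material_deriv_eq:
  assumes "((\<lambda>(t, x). f t x) has_derivative F) (at (t, x))"
  shows "material_deriv u f t x = F (1, u t x)"
proof -
  interpret F: linear F using assms by (rule has_derivative_linear)
  have "(1, u t x) = (1, 0) + (\<Sum>i\<in>UNIV. (u t x $ i) *\<^sub>R (0 :: real, axis i 1 :: real^3))"
    by (auto simp: prod_eq_iff fst_sum snd_sum vec_eq_iff axis_def if_distrib cong: if_cong)
  then have "F (1, u t x) = F (1, 0) + (\<Sum>i\<in>UNIV. (u t x $ i) *\<^sub>R F (0, axis i 1))"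
    by (simp only: F.add F.sum F.scaleR)
  then show ?thesis
    by (simp add: material_deriv_def dt_eq[OF assms] dx_eq[OF assms])
qed

section \<open>Radial functions\<close>

text \<open>
  Away from \<open>0\<close> this is the chain rule. At \<open>0\<close> the norm is not differentiable, but a vanishing
  one-sided slope of \<open>g\<close> makes \<open>g (norm v) - g 0\<close> of smaller order than \<open>norm v\<close>. Since \<open>sgn 0 = 0\<close>, a single
  formula covers both cases.
\<close>

lemma has_derivative_radial:
  fixes g g' :: "real \<Rightarrow> real" and y :: "'a::real_inner"
  assumes g: "\<And>s. s \<in> {0..<1} \<Longrightarrow> (g has_real_derivative g' s) (at s within {0..<1})"
    and g0: "g' 0 = 0" and y: "norm y < 1"
  shows "((\<lambda>y. g (norm y)) has_derivative (\<lambda>v. g' (norm y) * (sgn y \<bullet> v))) (at y)"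
proof (cases "y = 0")
  case True
  have "filterlim (\<lambda>v::'a. norm v) (at 0 within {0..<1}) (at 0)"
    unfolding filterlim_at
  proof (intro conjI)
    have "\<forall>\<^sub>F v::'a in at 0. v \<in> ball 0 1 - {0}"
      by (intro eventually_at_in_open) auto
    then show "\<forall>\<^sub>F v::'a in at 0. norm v \<in> {0..<1} \<and> norm v \<noteq> 0"
      by eventually_elim auto
    show "((\<lambda>v::'a. norm v) \<longlongrightarrow> 0) (at 0)"
      by (rule tendsto_norm_zero[OF tendsto_ident_at])
  qed
  moreover have "((\<lambda>s. (g s - g 0) / (s - 0)) \<longlongrightarrow> 0) (at 0 within {0..<1})"
    using g[of 0] g0 by (simp add: has_field_derivative_iff)
  ultimately have "((\<lambda>v::'a. (g (norm v) - g 0) / (norm v - 0)) \<longlongrightarrow> 0) (at 0)"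
    by (rule filterlim_compose[rotated])
  then have "((\<lambda>v::'a. \<bar>(g (norm v) - g 0) / norm v\<bar>) \<longlongrightarrow> 0) (at 0)"
    by (intro tendsto_rabs_zero) simp
  then show ?thesis
    using True g0 by (simp add: has_derivative_iff_norm)
next
  case False
  have "at (norm y) within {0..<1} = at (norm y)"
    using y False by (intro at_within_interior) auto
  then have "(g has_derivative (\<lambda>v. g' (norm y) * v)) (at (norm y))"
    using g[of "norm y"] y by (simp add: has_field_derivative_def)
  from has_derivative_compose[OF has_derivative_norm[OF False] this]
  show ?thesis by (simp add: inner_commute)
qed

text \<open>
  The direction \<open>sgn y\<close> jumps at \<open>0\<close>, but it is bounded and its factor tends to \<open>g' 0 = 0\<close>.
\<close>

lemma continuous_on_radial_gradient:
  fixes g' :: "real \<Rightarrow> real"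
  assumes g': "continuous_on {0..<1} g'" and g0: "g' 0 = 0"
  shows "continuous_on (ball 0 1) (\<lambda>y::'a::real_inner. g' (norm y) *\<^sub>R sgn y)"
  unfolding continuous_on_def
proof
  have cn: "continuous_on (ball 0 1) (\<lambda>y::'a. g' (norm y))"
    by (rule continuous_on_compose2[OF g']) (auto intro!: continuous_intros)
  fix y :: 'a assume y: "y \<in> ball 0 1"
  then have lim: "((\<lambda>y. g' (norm y)) \<longlongrightarrow> g' (norm y)) (at y within ball 0 1)"
    using cn by (auto simp: continuous_on_def)
  show "((\<lambda>y. g' (norm y) *\<^sub>R sgn y) \<longlongrightarrow> g' (norm y) *\<^sub>R sgn y) (at y within ball 0 1)"
  proof (cases "y = 0")
    case True
    then have "((\<lambda>y. \<bar>g' (norm y)\<bar>) \<longlongrightarrow> 0) (at y within ball 0 1)"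
      using lim g0 by (simp add: tendsto_rabs_zero)
    then have "((\<lambda>y. g' (norm y) *\<^sub>R sgn y) \<longlongrightarrow> 0) (at y within ball 0 1)"
      by (rule Lim_null_comparison[rotated]) (auto simp: norm_sgn)
    then show ?thesis using True by simp
  next
    case False
    then show ?thesis by (intro tendsto_intros lim tendsto_sgn)
  qed
qed

section \<open>Profiles\<close>

context
  fixes f :: "real \<Rightarrow> real"
  assumes f: "f \<in> profiles"
begin

text \<open>
  For the density profile \<open>f\<close> the integral is the pressure profile. Its slope \<open>- s f s\<close> is, up to the
  time-dependent factor, the force that balances the acceleration.
\<close>

lemma pressure_profile_deriv:
  assumes "s \<in> {0..1}"
  shows "((\<lambda>s. integral {s..1} (\<lambda>\<sigma>. \<sigma> * f \<sigma>)) has_real_derivative - (s * f s)) (at s within {0..1})"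
  by (rule integral_has_real_derivative'[OF _ assms])
     (use f in \<open>auto simp: profiles_def intro!: continuous_intros\<close>)

lemma pressure_profile_pos:
  assumes "s \<in> {0..<1}"
  shows "0 < integral {s..1} (\<lambda>\<sigma>. \<sigma> * f \<sigma>)"
proof -
  let ?I = "\<lambda>s. integral {s..1} (\<lambda>\<sigma>. \<sigma> * f \<sigma>)"
  have "(?I has_derivative (*) (- (z * f z))) (at z within {s..1})" if "s \<le> z" "z \<le> 1" for z
    using has_field_derivative_subset[OF pressure_profile_deriv[of z], of "{s..1}"] that assms
    by (auto simp: has_field_derivative_def)
  then obtain z where z: "z \<in> {s<..<1}" and "?I 1 - ?I s = - (z * f z) * (1 - s)"
    using mvt_simple[of s 1 ?I "\<lambda>z. (*) (- (z * f z))"] assms by auto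
  then have "?I s = z * f z * (1 - s)" by simp
  moreover have "0 < z * f z * (1 - s)"
    using z assms f by (auto simp: profiles_def intro!: mult_pos_pos)
  ultimately show ?thesis by simp
qed

text \<open>
  By l'Hopital's rule: the quotient of the derivatives is
  \<open>s (1 - s) powr (- \<delta>) f s / (\<delta> + 1)\<close>.
\<close>

lemma pressure_profile_asymptotics:
  assumes \<delta>: "0 < \<delta>" and L: "((\<lambda>s. (1 - s) powr (- \<delta>) * f s) \<longlongrightarrow> L) (at_left 1)"
  shows "((\<lambda>s. integral {s..1} (\<lambda>\<sigma>. \<sigma> * f \<sigma>) / (1 - s) powr (\<delta> + 1)) \<longlongrightarrow> L / (\<delta> + 1)) (at_left 1)"
proof (rule lhopital_left)
  let ?I = "\<lambda>s. integral {s..1} (\<lambda>\<sigma>. \<sigma> * f \<sigma>)"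
  have left: "at 1 within {0..1} = at_left (1::real)"
    by (rule at_within_Icc_at_left) simp
  have ev: "\<forall>\<^sub>F s in at_left (1::real). s \<in> {0<..<1}"
    by (rule eventually_at_left_real) simp
  have "(?I \<longlongrightarrow> ?I 1) (at 1 within {0..1})"
    using DERIV_isCont pressure_profile_deriv[of 1] has_field_derivative_imp_has_derivative
      has_derivative_continuous by (fastforce simp: continuous_within)
  then show "(?I \<longlongrightarrow> 0) (at_left 1)" by (simp add: left)
  have "((\<lambda>s::real. 1 - s) \<longlongrightarrow> 1 - 1) (at_left 1)" by (intro tendsto_intros)
  then show "((\<lambda>s. (1 - s) powr (\<delta> + 1)) \<longlongrightarrow> 0) (at_left 1)"
    using \<delta> ev by (intro tendsto_zero_powrI[where b = "\<delta> + 1"]) (auto elim!: eventually_mono)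
  show "\<forall>\<^sub>F s in at_left 1. (1 - s) powr (\<delta> + 1) \<noteq> 0"
    using ev by eventually_elim auto
  show "\<forall>\<^sub>F s in at_left 1. - (\<delta> + 1) * (1 - s) powr \<delta> \<noteq> 0"
    using ev by eventually_elim (use \<delta> in auto)
  show "\<forall>\<^sub>F s in at_left 1. (?I has_real_derivative - (s * f s)) (at s)"
    using ev
  proof eventually_elim
    case (elim s)
    then have "at s within {0..1} = at s" by (intro at_within_interior) auto
    then show ?case using pressure_profile_deriv[of s] elim by auto
  qed
  show "\<forall>\<^sub>F s in at_left 1. ((\<lambda>s. (1 - s) powr (\<delta> + 1)) has_real_derivative
      - (\<delta> + 1) * (1 - s) powr \<delta>) (at s)"
    using ev by eventually_elim (auto intro!: derivative_eq_intros simp: algebra_simps)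
  have "((\<lambda>s. s * ((1 - s) powr (- \<delta>) * f s) / (\<delta> + 1)) \<longlongrightarrow> 1 * L / (\<delta> + 1)) (at_left 1)"
    using \<delta> by (intro tendsto_intros L) auto
  moreover have "\<forall>\<^sub>F s in at_left 1. s * ((1 - s) powr (- \<delta>) * f s) / (\<delta> + 1) =
      - (s * f s) / (- (\<delta> + 1) * (1 - s) powr \<delta>)"
    using ev by eventually_elim (use \<delta> in \<open>simp add: powr_minus divide_simps, simp add: algebra_simps\<close>)
  ultimately show "((\<lambda>s. - (s * f s) / (- (\<delta> + 1) * (1 - s) powr \<delta>)) \<longlongrightarrow> L / (\<delta> + 1)) (at_left 1)"
    by (simp add: tendsto_cong)
qed

context
  fixes \<gamma> \<delta> L :: real and e :: "real \<Rightarrow> real"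
  assumes \<gamma>: "\<gamma> > 1" and \<delta>: "0 < \<delta>" and L: "0 < L"
    and lim: "((\<lambda>s. (1 - s) powr (- \<delta>) * f s) \<longlongrightarrow> L) (at_left 1)"
    and e: "\<And>s. 0 \<le> s \<Longrightarrow> s < 1 \<Longrightarrow>
           e s = integral {s..1} (\<lambda>\<sigma>. \<sigma> * f \<sigma>) / ((\<gamma> - 1) * f s)"
    and e1: "e 1 = 0"
begin

text \<open>
  The order of vanishing of the pressure integral exceeds that of \<open>f\<close> by exactly one, so the
  energy profile vanishes to first order at \<open>1\<close>, for every \<open>\<delta>\<close>.
\<close>

lemma energy_profile_slope:
  "((\<lambda>s. e s / (1 - s)) \<longlongrightarrow> 1 / ((\<gamma> - 1) * (\<delta> + 1))) (at_left 1)"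
proof -
  have "((\<lambda>s. integral {s..1} (\<lambda>\<sigma>. \<sigma> * f \<sigma>) / (1 - s) powr (\<delta> + 1) /
      ((\<gamma> - 1) * ((1 - s) powr (- \<delta>) * f s))) \<longlongrightarrow> L / (\<delta> + 1) / ((\<gamma> - 1) * L)) (at_left 1)"
    using \<gamma> L by (intro tendsto_intros lim pressure_profile_asymptotics[OF \<delta> lim]) auto
  moreover have "L / (\<delta> + 1) / ((\<gamma> - 1) * L) = 1 / ((\<gamma> - 1) * (\<delta> + 1))"
    using L by (simp add: mult.commute)
  moreover have "\<forall>\<^sub>F s in at_left (1::real). s \<in> {0<..<1}"
    by (rule eventually_at_left_real) simp
  then have "\<forall>\<^sub>F s in at_left 1. integral {s..1} (\<lambda>\<sigma>. \<sigma> * f \<sigma>) / (1 - s) powr (\<delta> + 1) /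
      ((\<gamma> - 1) * ((1 - s) powr (- \<delta>) * f s)) = e s / (1 - s)"
  proof eventually_elim
    case (elim s)
    then have "(1 - s) powr (\<delta> + 1) * (1 - s) powr (- \<delta>) = 1 - s"
      by (simp flip: powr_add)
    then have "(1 - s) powr (\<delta> + 1) * ((\<gamma> - 1) * ((1 - s) powr (- \<delta>) * f s)) =
        (1 - s) * ((\<gamma> - 1) * f s)"
      by (metis mult.assoc mult.left_commute)
    then show ?case
      using elim by (simp add: e)
  qed
  ultimately show ?thesis
    by (simp add: tendsto_cong)
qed

text \<open>
  Smoothness on \<open>{0..<1}\<close> comes from the quotient rule: both terms of the numerator of the derivative vanish
  at \<open>0\<close>, one because of the factor \<open>s\<close>, the other because \<open>f\<close> has zero slope there. Continuity
  at \<open>1\<close> is not evident from the formula, where numerator and denominator both vanish; it follows from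
  the first-order decay just found.
\<close>

lemma energy_profile_in_profiles: "e \<in> profiles"
proof -
  obtain f' where f': "\<And>s. s \<in> {0..<1} \<Longrightarrow> (f has_real_derivative f' s) (at s within {0..<1})"
    and f'_cont: "continuous_on {0..<1} f'" and f'0: "f' 0 = 0"
    and pos: "\<And>s. s \<in> {0..<1} \<Longrightarrow> 0 < f s"
    and f_cont: "continuous_on {0..1} f"
    using f unfolding profiles_def by blast
  let ?I = "\<lambda>s. integral {s..1} (\<lambda>\<sigma>. \<sigma> * f \<sigma>)"
  define e' where "e' s = - (s * f s * f s + ?I s * f' s) / ((\<gamma> - 1) * (f s * f s))" for s
  have I: "(?I has_real_derivative - (s * f s)) (at s within {0..<1})" if "s \<in> {0..<1}" for s
    using pressure_profile_deriv[of s] that by (auto intro: has_field_derivative_subset)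
  have der: "(e has_real_derivative e' s) (at s within {0..<1})" if s: "s \<in> {0..<1}" for s
  proof -
    have nz: "(\<gamma> - 1) * f s \<noteq> 0"
      using pos[OF s] \<gamma> by simp
    have "((\<lambda>s. ?I s / ((\<gamma> - 1) * f s)) has_real_derivative
        (- (s * f s) * ((\<gamma> - 1) * f s) - ?I s * ((\<gamma> - 1) * f' s)) /
        (((\<gamma> - 1) * f s) * ((\<gamma> - 1) * f s))) (at s within {0..<1})"
      by (intro DERIV_divide I[OF s] DERIV_cmult f'[OF s] nz)
    also have "(- (s * f s) * ((\<gamma> - 1) * f s) - ?I s * ((\<gamma> - 1) * f' s)) /
        (((\<gamma> - 1) * f s) * ((\<gamma> - 1) * f s)) =
        ((\<gamma> - 1) * - (s * f s * f s + ?I s * f' s)) / ((\<gamma> - 1) * ((\<gamma> - 1) * (f s * f s)))"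
      by (simp add: algebra_simps)
    also have "\<dots> = e' s"
      using \<gamma> by (simp add: e'_def)
    finally show ?thesis
      by (rule has_field_derivative_transform_within[where d = 1]) (use s in \<open>auto simp: e\<close>)
  qed
  have I_cont: "continuous_on {0..<1} ?I"
    using I by (intro DERIV_continuous_on)
  have "continuous_on {0..<1} f" by (rule continuous_on_subset[OF f_cont]) auto
  then have e'_cont: "continuous_on {0..<1} e'"
    unfolding e'_def[abs_def]
    by (intro continuous_intros I_cont f'_cont) (use pos \<gamma> in \<open>auto simp: less_le\<close>)
  have "e' 0 = 0" by (simp add: e'_def f'0)
  have "e s > 0" if "s \<in> {0..<1}" for s
    using that pressure_profile_pos[OF that] pos[OF that] \<gamma> by (simp add: e)
  moreover have "continuous_on {0..1} e"
    unfolding continuous_on_eq_continuous_within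
  proof
    fix s :: real assume s: "s \<in> {0..1}"
    show "continuous (at s within {0..1}) e"
    proof (cases "s = 1")
      case True
      have left: "at 1 within {0..1} = at_left (1::real)"
        by (rule at_within_Icc_at_left) simp
      have "((\<lambda>s. e s / (1 - s) * (1 - s)) \<longlongrightarrow> 1 / ((\<gamma> - 1) * (\<delta> + 1)) * (1 - 1)) (at_left 1)"
        by (intro tendsto_intros energy_profile_slope)
      moreover have "\<forall>\<^sub>F s in at_left 1. e s / (1 - s) * (1 - s) = e s"
        using eventually_at_left_real[OF zero_less_one] by eventually_elim simp
      ultimately have "(e \<longlongrightarrow> 1 / ((\<gamma> - 1) * (\<delta> + 1)) * (1 - 1)) (at_left 1)"
        by (rule Lim_transform_eventually)
      then have "(e \<longlongrightarrow> 0) (at_left 1)" by simp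
      then show ?thesis by (simp add: True continuous_within left e1)
    next
      case False
      then have s': "s \<in> {0..<1}" using s by auto
      then have "continuous (at s within {0..<1}) e"
        using der by (blast intro: DERIV_continuous)
      moreover have "at s within {0..<1} = at s within {0..1}"
        using s' by (intro at_within_nhd[of s "{..<1}"]) auto
      ultimately show ?thesis by simp
    qed
  qed
  ultimately show ?thesis
    using der e'_cont \<open>e' 0 = 0\<close> e1 unfolding profiles_def
    by (intro CollectI conjI exI[of _ e']) auto
qed

end

end

section \<open>Ellipsoids and their normals\<close>

lemma norm_sq_inward:
  fixes y b :: "'a::real_inner"
  assumes y: "norm y = 1"
  shows "(norm (y - h *\<^sub>R b))\<^sup>2 = 1 - 2 * h * (y \<bullet> b) + h\<^sup>2 * (norm b)\<^sup>2"
  using y unfolding power2_norm_eq_inner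
  by (simp add: inner_diff_left inner_diff_right inner_commute power2_eq_square norm_eq_1
      algebra_simps)

text \<open>
  To first order in \<open>h\<close> the squared norms are \<open>1 \<mp> 2 h (y \<bullet> b)\<close>. The two parts are needed together to fix the
  sign of the outward normal.
\<close>

lemma eventually_norm_inward:
  fixes y b :: "'a::real_inner"
  assumes y: "norm y = 1" and b: "0 < y \<bullet> b"
  shows "\<forall>\<^sub>F h in at_right 0. norm (y - h *\<^sub>R b) < 1"
    and "\<forall>\<^sub>F h in at_right 0. norm (y + h *\<^sub>R b) > 1"
proof -
  note sq = norm_sq_inward[OF y, of _ b]
  have "((\<lambda>h. h * (norm b)\<^sup>2) \<longlongrightarrow> 0 * (norm b)\<^sup>2) (at_right 0)"
    by (intro tendsto_intros)
  then have "\<forall>\<^sub>F h in at_right 0. h * (norm b)\<^sup>2 < 2 * (y \<bullet> b)"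
    using b by (intro order_tendstoD) auto
  moreover have pos: "\<forall>\<^sub>F h::real in at_right 0. 0 < h"
    by (rule eventually_at_right_less)
  ultimately show "\<forall>\<^sub>F h in at_right 0. norm (y - h *\<^sub>R b) < 1"
  proof eventually_elim
    case (elim h)
    then have "h * (h * (norm b)\<^sup>2) < h * (2 * (y \<bullet> b))"
      by (intro mult_strict_left_mono)
    then have "(norm (y - h *\<^sub>R b))\<^sup>2 < 1\<^sup>2"
      unfolding sq by (simp add: power2_eq_square algebra_simps)
    then show ?case by (rule power2_less_imp_less) simp
  qed
  show "\<forall>\<^sub>F h in at_right 0. norm (y + h *\<^sub>R b) > 1"
    using pos
  proof eventually_elim
    case (elim h)
    have "(norm (y + h *\<^sub>R b))\<^sup>2 = 1 + 2 * h * (y \<bullet> b) + h\<^sup>2 * (norm b)\<^sup>2"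
      using sq[of "- h"] by simp
    moreover have "0 < 2 * h * (y \<bullet> b)" using elim b by simp
    moreover have "0 \<le> h\<^sup>2 * (norm b)\<^sup>2" by simp
    ultimately have "1\<^sup>2 < (norm (y + h *\<^sub>R b))\<^sup>2"
      unfolding power_one by linarith
    then show ?case by (rule power2_less_imp_less) simp
  qed
qed

lemma tendsto_inward_speed:
  fixes y b :: "'a::real_inner"
  assumes y: "norm y = 1"
  shows "((\<lambda>h. (1 - norm (y - h *\<^sub>R b)) / h) \<longlongrightarrow> y \<bullet> b) (at_right 0)"
proof -
  have r: "((\<lambda>h. norm (y - h *\<^sub>R b)) \<longlongrightarrow> norm (y - 0 *\<^sub>R b)) (at_right 0)"
    by (intro tendsto_intros)
  have "((\<lambda>h. (2 * (y \<bullet> b) - h * (norm b)\<^sup>2) / (1 + norm (y - h *\<^sub>R b))) \<longlongrightarrow>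
      (2 * (y \<bullet> b) - 0 * (norm b)\<^sup>2) / (1 + norm (y - 0 *\<^sub>R b))) (at_right 0)"
    using y by (intro tendsto_intros r) auto
  then have lim: "((\<lambda>h. (2 * (y \<bullet> b) - h * (norm b)\<^sup>2) / (1 + norm (y - h *\<^sub>R b))) \<longlongrightarrow> y \<bullet> b) (at_right 0)"
    using y by simp
  have "\<forall>\<^sub>F h::real in at_right 0. 0 < h"
    by (rule eventually_at_right_less)
  then have "\<forall>\<^sub>F h in at_right 0. (2 * (y \<bullet> b) - h * (norm b)\<^sup>2) / (1 + norm (y - h *\<^sub>R b))
      = (1 - norm (y - h *\<^sub>R b)) / h"
  proof eventually_elim
    case (elim h)
    have "(norm (y - h *\<^sub>R b))\<^sup>2 = 1 - 2 * h * (y \<bullet> b) + h\<^sup>2 * (norm b)\<^sup>2"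
      by (rule norm_sq_inward[OF y])
    then have "h * (2 * (y \<bullet> b) - h * (norm b)\<^sup>2)
        = (1 - norm (y - h *\<^sub>R b)) * (1 + norm (y - h *\<^sub>R b))"
      by (simp add: power2_eq_square algebra_simps)
    moreover have "1 + norm (y - h *\<^sub>R b) \<noteq> 0"
      by (smt (verit) norm_ge_zero)
    ultimately show ?case
      using elim by (simp add: frac_eq_eq mult.commute)
  qed
  with lim show ?thesis by (rule Lim_transform_eventually)
qed

context
  fixes A B :: "real^'n^'n"
  assumes nz: "det A \<noteq> 0"
  defines "B \<equiv> matrix_inv A"
begin

lemma inv_mult: "A *v (B *v x) = x" "B *v (A *v x) = x"
  by (simp_all add: B_def matrix_vector_mul_assoc matrix_inv_left matrix_inv_right nz)

lemma ellipsoid_eq: "(\<lambda>y. A *v y) ` ball 0 1 = {x. norm (B *v x) < 1}"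
proof (intro set_eqI iffI)
  fix x assume "x \<in> {x. norm (B *v x) < 1}"
  then show "x \<in> (\<lambda>y. A *v y) ` ball 0 1"
    by (intro image_eqI[of _ _ "B *v x"]) (auto simp: inv_mult)
qed (auto simp: inv_mult)

lemma closure_ellipsoid: "closure ((\<lambda>y. A *v y) ` ball 0 1) = {x. norm (B *v x) \<le> 1}"
proof -
  have "closure ((\<lambda>y. A *v y) ` ball 0 1) = (\<lambda>y. A *v y) ` cball 0 1"
    by (subst closure_injective_linear_image[symmetric])
       (auto intro!: inj_onI, metis inv_mult(2))
  also have "\<dots> = {x. norm (B *v x) \<le> 1}"
  proof (intro set_eqI iffI)
    fix x assume "x \<in> {x. norm (B *v x) \<le> 1}"
    then show "x \<in> (\<lambda>y. A *v y) ` cball 0 1"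
      by (intro image_eqI[of _ _ "B *v x"]) (auto simp: inv_mult)
  qed (auto simp: inv_mult)
  finally show ?thesis .
qed

lemma frontier_ellipsoid: "frontier ((\<lambda>y. A *v y) ` ball 0 1) = {x. norm (B *v x) = 1}"
proof -
  have "open {x. norm (B *v x) < 1}"
    by (intro open_Collect_less continuous_intros)
  then have "frontier ((\<lambda>y. A *v y) ` ball 0 1) = {x. norm (B *v x) \<le> 1} - {x. norm (B *v x) < 1}"
    unfolding frontier_def closure_ellipsoid by (simp add: ellipsoid_eq interior_open)
  also have "\<dots> = {x. norm (B *v x) = 1}"
    by (rule set_eqI) (simp, linarith)
  finally show ?thesis .
qed

text \<open>
  The vector is half the gradient of the defining function \<open>(norm (B *v x))\<^sup>2\<close>, which is constant along every curve
  in the ellipsoid surface.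
\<close>

lemma is_normal_ellipsoid_conormal:
  assumes x: "norm (B *v x) = 1"
  shows "is_normal {x. norm (B *v x) = 1} x ((B *v x) v* B)"
  unfolding is_normal_def
proof (intro conjI ballI)
  have "((B *v x) v* B) \<bullet> x = 1"
    using x by (simp add: dot_lmul_matrix norm_eq_1)
  then show "(B *v x) v* B \<noteq> 0" by auto
next
  fix v assume "v \<in> tangent_vectors {x. norm (B *v x) = 1} x"
  then obtain e c where e: "e > 0" and c: "\<forall>s\<in>{-e<..<e}. norm (B *v c s) = 1" "c 0 = x"
    and der: "(c has_vector_derivative v) (at 0)"
    unfolding tangent_vectors_def by auto
  have "((\<lambda>s. B *v c s) has_vector_derivative B *v v) (at 0)"
    by (intro bounded_linear.has_vector_derivative[OF _ der] matrix_vector_mul_bounded_linear)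
  from bounded_bilinear.has_vector_derivative[OF bounded_bilinear_inner this this]
  have "((\<lambda>s. (B *v c s) \<bullet> (B *v c s)) has_vector_derivative 2 * ((B *v x) \<bullet> (B *v v))) (at 0)"
    by (simp add: c inner_commute)
  moreover have "((\<lambda>s. (B *v c s) \<bullet> (B *v c s)) has_vector_derivative 0) (at 0)"
    by (rule has_vector_derivative_transform_within_open[of "\<lambda>_. 1" _ _ "{-e<..<e}"])
       (use e c in \<open>auto simp: norm_eq_1\<close>)
  ultimately show "((B *v x) v* B) \<bullet> v = 0"
    by (auto simp: dot_lmul_matrix dest: vector_derivative_unique_at)
qed

text \<open>
  Image under \<open>A\<close> of the great circle through \<open>B *v x\<close> with velocity \<open>w\<close>.
\<close>

lemma ellipsoid_tangent:
  assumes x: "norm (B *v x) = 1" and w: "norm w = 1" "(B *v x) \<bullet> w = 0"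
  shows "A *v w \<in> tangent_vectors {x. norm (B *v x) = 1} x"
proof -
  define c where "c s = A *v (cos s *\<^sub>R (B *v x) + sin s *\<^sub>R w)" for s :: real
  define d where "d s = A *v (- sin s *\<^sub>R (B *v x) + cos s *\<^sub>R w)" for s :: real
  have der: "(c has_vector_derivative d s) (at s)" for s
    unfolding c_def[abs_def] d_def
    by (intro bounded_linear.has_vector_derivative[OF matrix_vector_mul_bounded_linear])
       (auto intro!: derivative_eq_intros)
  have "continuous_on {-1<..<1} d"
    unfolding d_def[abs_def]
    by (intro continuous_on_matrix_vector_mult continuous_intros)
  then have "c C1_differentiable_on {-1<..<1}"
    unfolding C1_differentiable_on_def using der by auto
  moreover have "norm (B *v c s) = 1" for s
  proof -
    have "norm (B *v c s) = norm (cos s *\<^sub>R (B *v x) + sin s *\<^sub>R w)"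
      by (simp add: c_def inv_mult)
    also have "(\<dots>)\<^sup>2 = (cos s)\<^sup>2 + (sin s)\<^sup>2"
      using x w unfolding power2_norm_eq_inner
      by (simp add: inner_add_left inner_add_right inner_commute norm_eq_1 power2_eq_square)
    finally show ?thesis by (simp add: power2_eq_1_iff) (smt (verit) norm_ge_zero)
  qed
  moreover have "c 0 = x" "d 0 = A *v w"
    by (simp_all add: c_def d_def inv_mult)
  ultimately show ?thesis
    using der[of 0] unfolding tangent_vectors_def mem_Collect_eq
    by (intro exI[of _ "1::real"] exI[of _ c]) auto
qed

text \<open>
  The images of vectors tangent to the sphere span the tangent space of the ellipsoid surface. Hence, pulled
  back by \<open>A\<close>, a normal is orthogonal to everything that is orthogonal to \<open>B *v x\<close>. This gives
  uniqueness of the unit normal up to sign.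
\<close>

lemma ellipsoid_normal_parallel:
  assumes x: "norm (B *v x) = 1" and n: "is_normal {x. norm (B *v x) = 1} x n"
  shows "n = ((B *v x) \<bullet> (n v* A)) *\<^sub>R ((B *v x) v* B)"
proof -
  define y where "y = B *v x"
  define z where "z = n v* A - (y \<bullet> (n v* A)) *\<^sub>R y"
  have zy: "y \<bullet> z = 0"
    using x by (simp add: z_def y_def inner_diff_right norm_eq_1)
  have "z = 0"
  proof (rule ccontr)
    assume "z \<noteq> 0"
    then have "A *v sgn z \<in> tangent_vectors {x. norm (B *v x) = 1} x"
      using x zy by (intro ellipsoid_tangent) (auto simp: norm_sgn sgn_div_norm y_def)
    then have "n \<bullet> (A *v sgn z) = 0"
      using n by (auto simp: is_normal_def)
    then have "(n v* A) \<bullet> z = 0"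
      using \<open>z \<noteq> 0\<close> by (simp add: dot_lmul_matrix sgn_div_norm matrix_vector_mult_scaleR)
    then have "z \<bullet> z = 0"
      using zy by (subst (1) z_def) (simp add: inner_diff_left)
    with \<open>z \<noteq> 0\<close> show False by simp
  qed
  then have "n v* A = (y \<bullet> (n v* A)) *\<^sub>R y"
    by (simp add: z_def)
  from arg_cong[OF this, of "\<lambda>v. v v* B"]
  have "(n v* A) v* B = (y \<bullet> (n v* A)) *\<^sub>R (y v* B)"
    by (simp only: scaleR_vector_matrix_assoc)
  moreover have "(n v* A) v* B = n"
    by (simp add: vector_matrix_mul_assoc B_def matrix_inv_right nz)
  ultimately show ?thesis by (simp add: y_def)
qed

lemma outward_unit_normal_ellipsoid:
  assumes x: "norm (B *v x) = 1"
  shows "outward_unit_normal ((\<lambda>y. A *v y) ` ball 0 1) x = sgn ((B *v x) v* B)"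
  unfolding outward_unit_normal_def frontier_ellipsoid closure_ellipsoid
  unfolding ellipsoid_eq
proof (rule the_equality)
  define \<nu> where "\<nu> = (B *v x) v* B"
  have \<nu>: "is_normal {x. norm (B *v x) = 1} x \<nu>"
    unfolding \<nu>_def by (rule is_normal_ellipsoid_conormal[OF x])
  then have k: "norm \<nu> > 0" by (simp add: is_normal_def)
  have yB: "(B *v x) \<bullet> (B *v v) = \<nu> \<bullet> v" for v
    by (simp add: \<nu>_def dot_lmul_matrix)
  have line: "B *v (x - h *\<^sub>R n) = B *v x - h *\<^sub>R (B *v n)"
    "B *v (x + h *\<^sub>R n) = B *v x + h *\<^sub>R (B *v n)" for h n
    by (simp_all add: matrix_vector_mult_diff_distrib matrix_vector_right_distrib
        matrix_vector_mult_scaleR)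
  have "0 < (B *v x) \<bullet> (B *v sgn \<nu>)"
    using k by (simp add: yB sgn_div_norm)
  from eventually_norm_inward[OF x this]
  have "\<forall>\<^sub>F h in at_right 0. x - h *\<^sub>R sgn \<nu> \<in> {x. norm (B *v x) < 1} \<and>
      x + h *\<^sub>R sgn \<nu> \<notin> {x. norm (B *v x) \<le> 1}"
    by eventually_elim (simp add: line)
  moreover have "norm (sgn \<nu>) = 1" "is_normal {x. norm (B *v x) = 1} x (sgn \<nu>)"
    using k \<nu> by (auto simp: is_normal_def norm_sgn sgn_div_norm)
  ultimately show "norm (sgn \<nu>) = 1 \<and> is_normal {x. norm (B *v x) = 1} x (sgn \<nu>) \<and>
      (\<forall>\<^sub>F h in at_right 0. x - h *\<^sub>R sgn \<nu> \<in> {x. norm (B *v x) < 1} \<and>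
      x + h *\<^sub>R sgn \<nu> \<notin> {x. norm (B *v x) \<le> 1})" by blast
  fix n
  assume n: "norm n = 1 \<and> is_normal {x. norm (B *v x) = 1} x n \<and>
      (\<forall>\<^sub>F h in at_right 0. x - h *\<^sub>R n \<in> {x. norm (B *v x) < 1} \<and>
      x + h *\<^sub>R n \<notin> {x. norm (B *v x) \<le> 1})"
  then obtain l where l: "n = l *\<^sub>R \<nu>"
    using ellipsoid_normal_parallel[OF x] unfolding \<nu>_def by blast
  \<comment> \<open>A negative multiple would point into the domain.\<close>
  have "l > 0"
  proof (rule ccontr)
    assume "\<not> l > 0"
    moreover have "l \<noteq> 0" using n l by auto
    ultimately have "0 < (B *v x) \<bullet> - (B *v n)"
      using k by (simp add: yB l mult_less_0_iff)
    from eventually_norm_inward(2)[OF x this]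
    have "\<forall>\<^sub>F h in at_right 0. 1 < norm (B *v (x - h *\<^sub>R n))"
      by (simp add: line)
    moreover from n have "\<forall>\<^sub>F h in at_right 0. x - h *\<^sub>R n \<in> {x. norm (B *v x) < 1} \<and>
      x + h *\<^sub>R n \<notin> {x. norm (B *v x) \<le> 1}" by blast
    ultimately have "\<forall>\<^sub>F h in at_right (0::real). False"
      by eventually_elim simp
    then show False by simp
  qed
  then show "n = sgn ((B *v x) v* B)"
  proof -
    have "\<bar>l\<bar> * norm \<nu> = 1" using n l by (metis norm_scaleR)
    then have "l = inverse (norm \<nu>)"
      using \<open>l > 0\<close> by (metis abs_of_pos inverse_unique mult.commute)
    then show ?thesis by (simp add: l sgn_div_norm flip: \<nu>_def)
  qed
qed

text \<open>
  The difference quotient is the product of \<open>g r / (1 - r)\<close>, where \<open>r\<close> is the radius of the label at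
  distance \<open>h\<close> from the boundary, and \<open>(1 - r) / h\<close>, the speed at which that radius leaves \<open>1\<close>.
\<close>

lemma has_normal_derivative_ellipsoid:
  fixes g :: "real \<Rightarrow> real"
  assumes x: "norm (B *v x) = 1" and g1: "g 1 = 0"
    and lim: "((\<lambda>s. g s / (1 - s)) \<longlongrightarrow> L) (at_left 1)"
  shows "has_normal_derivative (\<lambda>x. g (norm (B *v x)) / c) (- (L * norm ((B *v x) v* B) / c))
           ((\<lambda>y. A *v y) ` ball 0 1) x"
proof -
  define n where "n = sgn ((B *v x) v* B)"
  define r where "r h = norm (B *v x - h *\<^sub>R (B *v n))" for h
  have yn: "(B *v x) \<bullet> (B *v n) = norm ((B *v x) v* B)"
    by (simp add: n_def sgn_div_norm norm_eq_sqrt_inner real_div_sqrt divide_inverse_commute[symmetric]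
        flip: dot_lmul_matrix)
  have "(B *v x) v* B \<noteq> 0"
    using is_normal_ellipsoid_conormal[OF x] by (simp add: is_normal_def)
  then have r1: "\<forall>\<^sub>F h in at_right 0. r h < 1"
    unfolding r_def by (intro eventually_norm_inward x) (simp add: yn)
  have "(r \<longlongrightarrow> norm (B *v x - 0 *\<^sub>R (B *v n))) (at_right 0)"
    unfolding r_def[abs_def] by (intro tendsto_intros)
  with r1 have "filterlim r (at_left 1) (at_right 0)"
    using x by (auto simp: filterlim_at elim!: eventually_mono)
  then have "((\<lambda>h. g (r h) / (1 - r h)) \<longlongrightarrow> L) (at_right 0)"
    by (rule filterlim_compose[OF lim])
  moreover have "((\<lambda>h. (1 - r h) / h) \<longlongrightarrow> norm ((B *v x) v* B)) (at_right 0)"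
    using tendsto_inward_speed[OF x, of "B *v n"] by (simp add: yn r_def)
  ultimately have "((\<lambda>h. - (g (r h) / (1 - r h) * ((1 - r h) / h)) * (1 / c)) \<longlongrightarrow>
      - (L * norm ((B *v x) v* B)) * (1 / c)) (at_right 0)"
    by (intro tendsto_intros)
  then have "((\<lambda>h. - (g (r h) / (1 - r h) * ((1 - r h) / h)) * (1 / c)) \<longlongrightarrow>
      - (L * norm ((B *v x) v* B) / c)) (at_right 0)" by simp
  moreover have "\<forall>\<^sub>F h in at_right 0. - (g (r h) / (1 - r h) * ((1 - r h) / h)) * (1 / c) =
      (g (norm (B *v x)) / c - g (norm (B *v (x - h *\<^sub>R n))) / c) / h"
    using r1
  proof eventually_elim
    case (elim h)
    have "norm (B *v (x - h *\<^sub>R n)) = r h"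
      by (simp add: r_def matrix_vector_mult_diff_distrib matrix_vector_mult_scaleR)
    then show ?case using elim x g1 by simp
  qed
  ultimately show ?thesis
    unfolding has_normal_derivative_def outward_unit_normal_ellipsoid[OF x] n_def[symmetric]
    by (rule Lim_transform_eventually)
qed

end

section \<open>Fields transported by an affine motion\<close>

text \<open>
  A twice continuously differentiable curve of matrices with positive determinant, with its first two
  derivatives as parameters. The differential equation for \<open>A\<close> enters through the value of \<open>W\<close>.
\<close>

locale affine_motion =
  fixes A V W :: "real \<Rightarrow> real^3^3"
  assumes A_deriv: "(A has_vector_derivative V t) (at t)"
    and V_deriv: "(V has_vector_derivative W t) (at t)"
    and W_cont: "continuous_on UNIV W"
    and det_pos: "det (A t) > 0"
begin

text \<open>
  \<open>B t *v x\<close> is the Lagrangian label of the particle that is at \<open>x\<close> at time \<open>t\<close>, and \<open>M t\<close> is the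
  velocity gradient.
\<close>

definition B :: "real \<Rightarrow> real^3^3" where "B t = matrix_inv (A t)"

definition M :: "real \<Rightarrow> real^3^3" where "M t = V t ** B t"

lemma det_nonzero: "det (A t) \<noteq> 0"
  using det_pos[of t] by simp

lemma A_B: "A t ** B t = mat 1" "B t ** A t = mat 1"
  by (simp_all add: B_def matrix_inv_left matrix_inv_right det_nonzero)

lemma M_A: "M t ** A t = V t"
  by (simp add: M_def A_B flip: matrix_mul_assoc)

lemma A_cont: "continuous_on UNIV A"
  using A_deriv by (intro continuous_at_imp_continuous_on ballI has_vector_derivative_continuous)

lemma V_cont: "continuous_on UNIV V"
  using V_deriv by (intro continuous_at_imp_continuous_on ballI has_vector_derivative_continuous)

lemma B_cont: "continuous_on UNIV B"
  unfolding B_def[abs_def] by (intro continuous_on_matrix_inv A_cont det_nonzero)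

lemma M_cont: "continuous_on UNIV M"
  unfolding M_def[abs_def] by (intro continuous_on_matrix_matrix_mult V_cont B_cont)

lemma continuous_on_time:
  assumes "continuous_on UNIV f"
  shows "continuous_on S (\<lambda>z. f (fst z))"
  by (rule continuous_on_compose2[OF assms]) (auto intro!: continuous_intros)

lemma B_deriv: "(B has_vector_derivative - (B t ** M t)) (at t)"
  using has_vector_derivative_matrix_inv[OF A_deriv A_cont det_nonzero, of t]
  by (simp add: B_def[abs_def] M_def matrix_mul_assoc)

lemma M_deriv: "(M has_vector_derivative W t ** B t - M t ** M t) (at t)"
proof -
  interpret mm: bounded_bilinear "(**) :: real^3^3 \<Rightarrow> real^3^3 \<Rightarrow> real^3^3"
    by (rule bounded_bilinear_matrix_matrix_mult)
  have "(M has_vector_derivative V t ** - (B t ** M t) + W t ** B t) (at t)"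
    unfolding M_def[abs_def]
    by (rule mm.has_vector_derivative[OF V_deriv B_deriv[unfolded M_def]])
  then show ?thesis
    by (simp add: mm.minus_right M_def matrix_mul_assoc)
qed

lemma det_deriv: "((\<lambda>s. det (A s)) has_real_derivative trace (M t) * det (A t)) (at t)"
  by (rule has_real_derivative_det) (simp add: M_A A_deriv)

lemma det_powr_deriv:
  "((\<lambda>s. det (A s) powr a) has_real_derivative a * trace (M t) * det (A t) powr a) (at t)"
proof -
  have "((\<lambda>s. det (A s) powr a) has_real_derivative
      a * det (A t) powr (a - 1) * (trace (M t) * det (A t))) (at t)"
    using DERIV_chain2[OF _ det_deriv, of "\<lambda>x. x powr a"] det_pos[of t]
    by (auto intro!: has_real_derivative_powr)
  moreover have "det (A t) powr (a - 1) * det (A t) = det (A t) powr a"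
    using det_pos[of t] powr_add[of "det (A t)" "a - 1" 1] by simp
  ultimately show ?thesis
    by (simp add: algebra_simps) (metis mult.commute mult.left_commute)
qed

lemma det_powr_cont: "continuous_on UNIV (\<lambda>s. det (A s) powr a)"
  by (intro continuous_intros continuous_on_det A_cont) (simp add: det_nonzero)

lemma domain_at_eq: "domain_at A t = {x. norm (B t *v x) < 1}"
  by (simp add: domain_at_def ellipsoid_eq[OF det_nonzero] B_def)

lemma spacetime_eq: "spacetime A = {z. norm (B (fst z) *v snd z) < 1}"
  by (auto simp: spacetime_def domain_at_eq)

lemma lateral_boundary_eq: "lateral_boundary A = {z. norm (B (fst z) *v snd z) = 1}"
  by (auto simp: lateral_boundary_def domain_at_def frontier_ellipsoid[OF det_nonzero] B_def)

lemma label_cont: "continuous_on S (\<lambda>z. B (fst z) *v snd z)"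
  by (intro continuous_on_matrix_vector_mult continuous_on_time B_cont continuous_intros)

lemma closure_spacetime_subset: "closure (spacetime A) \<subseteq> {z. norm (B (fst z) *v snd z) \<le> 1}"
proof (rule closure_minimal)
  show "closed {z. norm (B (fst z) *v snd z) \<le> 1}"
    by (intro closed_Collect_le continuous_intros label_cont)
qed (auto simp: spacetime_eq)

text \<open>
  The derivative vanishes in the direction \<open>(1, M x)\<close>: labels are constant along trajectories.
\<close>

lemma label_deriv:
  "((\<lambda>z. B (fst z) *v snd z) has_derivative (\<lambda>v. B (fst z) *v (snd v - fst v *\<^sub>R (M (fst z) *v snd z)))) (at z)"
proof -
  interpret mv: bounded_bilinear "(*v) :: real^3^3 \<Rightarrow> real^3 \<Rightarrow> real^3"
    by (rule bounded_bilinear_matrix_vector_mult)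
  have "((\<lambda>z :: real \<times> (real^3). B (fst z)) has_derivative (\<lambda>v. fst v *\<^sub>R - (B (fst z) ** M (fst z)))) (at z)"
    by (rule has_derivative_compose[OF has_derivative_fst[OF has_derivative_ident]
          B_deriv[unfolded has_vector_derivative_def]])
  from mv.FDERIV[OF this has_derivative_snd[OF has_derivative_ident]]
  show ?thesis
    by (simp add: mv.diff_right mv.scaleR_left mv.scaleR_right mv.minus_left matrix_vector_mul_assoc
        scaleR_minus_right)
qed

lemma velocity_deriv:
  "((\<lambda>z. M (fst z) *v snd z) has_derivative
     (\<lambda>v. M (fst z) *v snd v + fst v *\<^sub>R ((W (fst z) ** B (fst z) - M (fst z) ** M (fst z)) *v snd z))) (at z)"
proof -
  interpret mv: bounded_bilinear "(*v) :: real^3^3 \<Rightarrow> real^3 \<Rightarrow> real^3"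
    by (rule bounded_bilinear_matrix_vector_mult)
  have "((\<lambda>z :: real \<times> (real^3). M (fst z)) has_derivative
      (\<lambda>v. fst v *\<^sub>R (W (fst z) ** B (fst z) - M (fst z) ** M (fst z)))) (at z)"
    by (rule has_derivative_compose[OF has_derivative_fst[OF has_derivative_ident]
          M_deriv[unfolded has_vector_derivative_def]])
  from mv.FDERIV[OF this has_derivative_snd[OF has_derivative_ident]]
  show ?thesis
    by (simp add: mv.scaleR_left)
qed

lemma C1_on_velocity: "C1_on S (\<lambda>z. M (fst z) *v snd z)"
proof (rule C1_onI)
  show "continuous_on S (\<lambda>z. M (fst z) *v snd v + fst v *\<^sub>R ((W (fst z) ** B (fst z) - M (fst z) ** M (fst z)) *v snd z))" for v
    by (intro continuous_on_add continuous_on_scaleR continuous_on_matrix_vector_mult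
        continuous_on_diff continuous_on_matrix_matrix_mult continuous_on_time M_cont W_cont B_cont
        continuous_on_const continuous_on_snd continuous_on_id)
qed (rule velocity_deriv)

lemma velocity_cont: "continuous_on S (\<lambda>z. M (fst z) *v snd z)"
  by (intro continuous_on_matrix_vector_mult continuous_on_time M_cont continuous_intros)

lemma material_deriv_velocity:
  "material_deriv (\<lambda>t x. M t *v x) (\<lambda>t x. M t *v x) t x = (W t ** B t) *v x"
proof -
  have "((\<lambda>(t, x). M t *v x) has_derivative (\<lambda>v. M t *v snd v +
      fst v *\<^sub>R ((W t ** B t - M t ** M t) *v x))) (at (t, x))"
    using velocity_deriv[of "(t, x)"] by (simp add: case_prod_unfold)
  from material_deriv_eq[OF this] show ?thesis
    by (simp add: matrix_vector_mult_diff_rdistrib matrix_vector_mul_assoc)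
qed

lemma divergence_velocity: "divergence (\<lambda>t x. M t *v x) t x = trace (M t)"
proof -
  have "dx i (\<lambda>s y. (M s *v y) $ i) t x = M t $ i $ i" for i
  proof -
    have "((\<lambda>(t, x). (M t *v x) $ i) has_derivative (\<lambda>v. (M t *v snd v +
      fst v *\<^sub>R ((W t ** B t - M t ** M t) *v x)) $ i)) (at (t, x))"
      using bounded_linear.has_derivative[OF bounded_linear_vec_nth velocity_deriv[of "(t, x)"]]
      by (simp add: case_prod_unfold)
    from dx_eq[OF this] show ?thesis
      by (simp add: matrix_vector_mult_basis column_def)
  qed
  then show ?thesis by (simp add: divergence_def trace_def)
qed

text \<open>
  Particles that start on the boundary of the moving domain stay on it.
\<close>

lemma flow_tangent:
  assumes "(t, x) \<in> lateral_boundary A"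
  shows "(1, M t *v x) \<in> tangent_vectors (lateral_boundary A) (t, x)"
proof -
  define c where "c s = (t + s, A (t + s) *v (B t *v x))" for s
  define d where "d s = (1 :: real, V (t + s) *v (B t *v x))" for s
  interpret mv: bounded_bilinear "(*v) :: real^3^3 \<Rightarrow> real^3 \<Rightarrow> real^3"
    by (rule bounded_bilinear_matrix_vector_mult)
  have der: "(c has_vector_derivative d s) (at s)" for s
  proof -
    have "((\<lambda>s. t + s) has_vector_derivative 1) (at s)"
      by (auto intro!: derivative_eq_intros)
    from vector_diff_chain_at[OF this A_deriv]
    have "((\<lambda>s. A (t + s)) has_vector_derivative V (t + s)) (at s)"
      by (simp add: o_def)
    then have "((\<lambda>s. A (t + s) *v (B t *v x)) has_vector_derivative V (t + s) *v (B t *v x)) (at s)"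
      by (rule bounded_linear.has_vector_derivative[OF mv.bounded_linear_left])
    then show ?thesis
      unfolding c_def[abs_def] d_def by (auto intro!: derivative_eq_intros)
  qed
  have "continuous_on {-1<..<1} (\<lambda>s. V (t + s))"
    by (rule continuous_on_compose2[OF V_cont]) (auto intro!: continuous_intros)
  then have "continuous_on {-1<..<1} d"
    unfolding d_def[abs_def] by (intro continuous_intros continuous_on_matrix_vector_mult)
  then have "c C1_differentiable_on {-1<..<1}"
    unfolding C1_differentiable_on_def using der by auto
  moreover have "c s \<in> lateral_boundary A" for s
    using assms by (simp add: lateral_boundary_eq c_def matrix_vector_mul_assoc matrix_mul_assoc A_B)
  moreover have "c 0 = (t, x)" "d 0 = (1, M t *v x)"
    by (simp_all add: c_def d_def M_def matrix_vector_mul_assoc A_B)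
  ultimately show ?thesis
    using der[of 0] unfolding tangent_vectors_def mem_Collect_eq
    by (intro exI[of _ "1::real"] exI[of _ c]) auto
qed

context
  fixes g g' h h' :: "real \<Rightarrow> real"
  assumes g: "\<And>s. s \<in> {0..<1} \<Longrightarrow> (g has_real_derivative g' s) (at s within {0..<1})"
    and g0: "g' 0 = 0"
    and h: "\<And>t. (h has_real_derivative h' t) (at t)"
begin

text \<open>
  The space-time derivative of \<open>h t * g (norm (B t *v x))\<close>, a product of an amplitude that depends on
  time only and a radial profile of the label.
\<close>

definition transported_derivative :: "real \<times> (real^3) \<Rightarrow> real \<times> (real^3) \<Rightarrow> real" where
  "transported_derivative z v =
     h (fst z) * (g' (norm (B (fst z) *v snd z)) *
       (sgn (B (fst z) *v snd z) \<bullet> (B (fst z) *v (snd v - fst v *\<^sub>R (M (fst z) *v snd z)))))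
     + h' (fst z) * fst v * g (norm (B (fst z) *v snd z))"

lemma transported_deriv:
  assumes "z \<in> spacetime A"
  shows "((\<lambda>z. h (fst z) * g (norm (B (fst z) *v snd z))) has_derivative transported_derivative z) (at z)"
proof -
  have "norm (B (fst z) *v snd z) < 1"
    using assms by (simp add: spacetime_eq)
  from has_derivative_compose[OF label_deriv has_derivative_radial[OF g g0 this]]
  have G: "((\<lambda>z. g (norm (B (fst z) *v snd z))) has_derivative
     (\<lambda>v. g' (norm (B (fst z) *v snd z)) *
       (sgn (B (fst z) *v snd z) \<bullet> (B (fst z) *v (snd v - fst v *\<^sub>R (M (fst z) *v snd z)))))) (at z)"
    by simp
  have H: "((\<lambda>z :: real \<times> (real^3). h (fst z)) has_derivative (\<lambda>v. h' (fst z) * fst v)) (at z)"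
    by (rule has_derivative_compose[OF has_derivative_fst[OF has_derivative_ident]
          h[unfolded has_field_derivative_def]])
  have "transported_derivative z = (\<lambda>v. h (fst z) * (g' (norm (B (fst z) *v snd z)) *
       (sgn (B (fst z) *v snd z) \<bullet> (B (fst z) *v (snd v - fst v *\<^sub>R (M (fst z) *v snd z)))))
     + h' (fst z) * fst v * g (norm (B (fst z) *v snd z)))"
    by (simp add: fun_eq_iff transported_derivative_def)
  then show ?thesis
    using has_derivative_mult[OF H G] by simp
qed

text \<open>
  Only the amplitude contributes, as the label does not change along the flow.
\<close>

lemma material_deriv_transported:
  assumes "(t, x) \<in> spacetime A"
  shows "material_deriv (\<lambda>t x. M t *v x) (\<lambda>t x. h t * g (norm (B t *v x))) t x =
    h' t * g (norm (B t *v x))"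
proof -
  have "((\<lambda>(t, x). h t * g (norm (B t *v x))) has_derivative transported_derivative (t, x)) (at (t, x))"
    using transported_deriv[OF assms] by (simp add: case_prod_unfold)
  from material_deriv_eq[OF this] show ?thesis
    by (simp add: transported_derivative_def)
qed

lemma grad_transported:
  assumes "(t, x) \<in> spacetime A"
  shows "grad (\<lambda>t x. h t * g (norm (B t *v x))) t x =
    (h t * g' (norm (B t *v x))) *\<^sub>R (sgn (B t *v x) v* B t)"
proof -
  have "((\<lambda>(t, x). h t * g (norm (B t *v x))) has_derivative transported_derivative (t, x)) (at (t, x))"
    using transported_deriv[OF assms] by (simp add: case_prod_unfold)
  from dx_eq[OF this] show ?thesis
    by (simp add: grad_def vec_eq_iff transported_derivative_def inner_axis flip: dot_lmul_matrix)
qed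

lemma C1_on_transported:
  assumes g'_cont: "continuous_on {0..<1} g'" and h'_cont: "continuous_on UNIV h'"
  shows "C1_on (spacetime A) (\<lambda>z. h (fst z) * g (norm (B (fst z) *v snd z)))"
proof (rule C1_onI)
  fix v :: "real \<times> (real^3)"
  have "(\<lambda>z. B (fst z) *v snd z) ` spacetime A \<subseteq> ball 0 1"
    by (auto simp: spacetime_eq)
  then have grad: "continuous_on (spacetime A)
      (\<lambda>z. g' (norm (B (fst z) *v snd z)) *\<^sub>R sgn (B (fst z) *v snd z))"
    by (rule continuous_on_compose2[OF continuous_on_radial_gradient[OF g'_cont g0] label_cont])
  have "continuous_on {0..<1} g"
    using g by (intro DERIV_continuous_on)
  then have gc: "continuous_on (spacetime A) (\<lambda>z. g (norm (B (fst z) *v snd z)))"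
    by (rule continuous_on_compose2) (auto simp: spacetime_eq intro!: continuous_intros label_cont)
  have hc: "continuous_on UNIV h"
    using h by (intro DERIV_continuous_on) (simp add: has_field_derivative_at_within)
  have "continuous_on (spacetime A) (\<lambda>z. h (fst z) *
      ((g' (norm (B (fst z) *v snd z)) *\<^sub>R sgn (B (fst z) *v snd z)) \<bullet>
       (B (fst z) *v (snd v - fst v *\<^sub>R (M (fst z) *v snd z))))
     + h' (fst z) * fst v * g (norm (B (fst z) *v snd z)))"
    by (intro continuous_on_add continuous_on_mult continuous_on_inner grad gc
        continuous_on_matrix_vector_mult continuous_on_time hc h'_cont B_cont M_cont
        continuous_on_diff continuous_on_scaleR continuous_on_const continuous_on_snd continuous_on_id)
  then show "continuous_on (spacetime A) (\<lambda>z. transported_derivative z v)"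
    by (simp add: transported_derivative_def)
qed (rule transported_deriv)

end

lemma transported_cont:
  fixes g h :: "real \<Rightarrow> real"
  assumes g: "continuous_on {0..1} g" and h: "continuous_on UNIV h"
  shows "continuous_on (closure (spacetime A)) (\<lambda>z. h (fst z) * g (norm (B (fst z) *v snd z)))"
proof -
  have "continuous_on (closure (spacetime A)) (\<lambda>z. g (norm (B (fst z) *v snd z)))"
    by (rule continuous_on_compose2[OF g continuous_on_norm[OF label_cont]])
       (use closure_spacetime_subset in auto)
  then show ?thesis
    by (intro continuous_on_mult continuous_on_time h)
qed

end

section \<open>The affine solution\<close>

theorem theorem1:
  fixes \<gamma> :: real
    and A0 A1 :: "real^3^3"
    and A :: "real \<Rightarrow> real^3^3"
    and \<rho>0 \<epsilon>0 :: "real \<Rightarrow> real"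
    and u :: "real \<Rightarrow> real^3 \<Rightarrow> real^3"
    and \<rho> \<epsilon> p :: "real \<Rightarrow> real^3 \<Rightarrow> real"
  assumes "\<gamma> > 1"
    and "A0 \<in> GL3_plus"
    and "global_affine_solution \<gamma> A0 A1 A"
    and "\<rho>0 \<in> profiles"
    and "\<exists>\<delta>>0. \<exists>L>0. ((\<lambda>s. (1 - s) powr (- \<delta>) * \<rho>0 s) \<longlongrightarrow> L) (at_left 1)"
    and "\<And>s. 0 \<le> s \<Longrightarrow> s < 1 \<Longrightarrow>
           \<epsilon>0 s = integral {s..1} (\<lambda>\<sigma>. \<sigma> * \<rho>0 \<sigma>) / ((\<gamma> - 1) * \<rho>0 s)"
    and "\<epsilon>0 1 = 0"
    and "\<And>t x. u t x = (curve_deriv A t ** matrix_inv (A t)) *v x"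
    and "\<And>t x. \<rho> t x = \<rho>0 (norm (matrix_inv (A t) *v x)) / det (A t)"
    and "\<And>t x. \<epsilon> t x = \<epsilon>0 (norm (matrix_inv (A t) *v x)) / det (A t) powr (\<gamma> - 1)"
    and "\<And>t x. p t x = (\<gamma> - 1) * \<rho> t x * \<epsilon> t x"
  shows "\<epsilon>0 \<in> profiles \<and>
    (continuous_on (closure (spacetime A)) (\<lambda>(t, x). u t x) \<and> C1_on (spacetime A) (\<lambda>(t, x). u t x)) \<and>
    (continuous_on (closure (spacetime A)) (\<lambda>(t, x). \<rho> t x) \<and> C1_on (spacetime A) (\<lambda>(t, x). \<rho> t x)) \<and>
    (continuous_on (closure (spacetime A)) (\<lambda>(t, x). \<epsilon> t x) \<and> C1_on (spacetime A) (\<lambda>(t, x). \<epsilon> t x)) \<and>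
    euler_equations_on (spacetime A) \<gamma> u \<rho> \<epsilon> p \<and>
    (\<forall>(t, x) \<in> lateral_boundary A.
       (\<forall>\<eta>. is_normal (lateral_boundary A) (t, x) \<eta> \<longrightarrow> \<eta> \<bullet> (1, u t x) = 0) \<and>
       p t x = 0 \<and>
       (\<exists>d<0. has_normal_derivative (\<epsilon> t) d (domain_at A t) x))"
proof -
  define V where "V = curve_deriv A"
  define W where "W = curve_deriv V"
  obtain D where D0: "D 0 = A" and D: "\<And>k t. (D k has_vector_derivative D (Suc k) t) (at t)"
    using assms(3) unfolding global_affine_solution_def smooth_curve_def by blast
  have V: "V = D 1"
    using D[of 0] by (auto simp: V_def curve_deriv_def D0 fun_eq_iff intro: vector_derivative_at)
  have W: "W = D 2"
    using D[of 1] by (auto simp: W_def curve_deriv_def V fun_eq_iff numeral_2_eq_2 intro: vector_derivative_at)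
  interpret affine_motion A V W
  proof
    fix t
    show "(A has_vector_derivative V t) (at t)" "(V has_vector_derivative W t) (at t)"
      using D[of 0 t] D[of 1 t] by (simp_all add: D0 V W numeral_2_eq_2)
    show "continuous_on UNIV W"
      using D[of 2] by (intro continuous_at_imp_continuous_on ballI)
        (auto simp: W intro: has_vector_derivative_continuous)
    show "det (A t) > 0"
      using assms(3) by (auto simp: global_affine_solution_def GL3_plus_def)
  qed
  have ode: "W t = det (A t) powr (1 - \<gamma>) *\<^sub>R transpose (B t)" for t
    using assms(3) by (auto simp: global_affine_solution_def W_def V_def B_def)

  have u_eq: "u = (\<lambda>t x. M t *v x)"
    by (simp add: fun_eq_iff assms(8) M_def B_def flip: V_def)
  have \<rho>_eq: "\<rho> = (\<lambda>t x. det (A t) powr (- 1) * \<rho>0 (norm (B t *v x)))"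
    using det_pos
    by (simp add: fun_eq_iff assms(9) B_def powr_minus divide_inverse mult.commute abs_of_pos)
  have \<epsilon>_eq: "\<epsilon> = (\<lambda>t x. det (A t) powr (- (\<gamma> - 1)) * \<epsilon>0 (norm (B t *v x)))"
    by (simp only: fun_eq_iff assms(10) B_def powr_minus divide_inverse mult.commute) simp
  \<comment> \<open>The pressure profile: up to the factor for time it is the pressure in terms of the label.\<close>
  define p0 where "p0 s = (\<gamma> - 1) * \<rho>0 s * \<epsilon>0 s" for s
  have p_eq: "p = (\<lambda>t x. det (A t) powr (- \<gamma>) * p0 (norm (B t *v x)))"
  proof (intro ext)
    fix t x
    have "det (A t) powr (- \<gamma>) = det (A t) powr (- 1) * det (A t) powr (- (\<gamma> - 1))"
      by (subst powr_add[symmetric]) simp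
    then show "p t x = det (A t) powr (- \<gamma>) * p0 (norm (B t *v x))"
      by (simp add: assms(11) \<rho>_eq \<epsilon>_eq p0_def)
  qed

  obtain \<delta> L where \<delta>: "\<delta> > 0" and L: "L > 0"
    and lim: "((\<lambda>s. (1 - s) powr (- \<delta>) * \<rho>0 s) \<longlongrightarrow> L) (at_left 1)"
    using assms(5) by blast
  have \<epsilon>0: "\<epsilon>0 \<in> profiles"
    by (rule energy_profile_in_profiles[OF assms(4,1) \<delta> L lim assms(6,7)])
  have slope: "((\<lambda>s. \<epsilon>0 s / (1 - s)) \<longlongrightarrow> 1 / ((\<gamma> - 1) * (\<delta> + 1))) (at_left 1)"
    by (rule energy_profile_slope[OF assms(4,1) \<delta> L lim assms(6,7)])
  obtain \<rho>0' where \<rho>0: "continuous_on {0..1} \<rho>0"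
    "\<And>s. s \<in> {0..<1} \<Longrightarrow> (\<rho>0 has_real_derivative \<rho>0' s) (at s within {0..<1})"
    "continuous_on {0..<1} \<rho>0'" "\<rho>0' 0 = 0" "\<And>s. s \<in> {0..<1} \<Longrightarrow> \<rho>0 s > 0"
    using assms(4) unfolding profiles_def by blast
  obtain \<epsilon>0' where \<epsilon>0': "continuous_on {0..1} \<epsilon>0"
    "\<And>s. s \<in> {0..<1} \<Longrightarrow> (\<epsilon>0 has_real_derivative \<epsilon>0' s) (at s within {0..<1})"
    "continuous_on {0..<1} \<epsilon>0'" "\<epsilon>0' 0 = 0"
    using \<epsilon>0 unfolding profiles_def by blast
  \<comment> \<open>This is where the definition of the energy profile enters: the factor of the density cancels.\<close>
  have p0: "(p0 has_real_derivative - (s * \<rho>0 s)) (at s within {0..<1})" if s: "s \<in> {0..<1}" for s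
  proof (rule has_field_derivative_transform_within[where d = 1])
    show "((\<lambda>s. integral {s..1} (\<lambda>\<sigma>. \<sigma> * \<rho>0 \<sigma>)) has_real_derivative - (s * \<rho>0 s)) (at s within {0..<1})"
      by (rule has_field_derivative_subset[OF pressure_profile_deriv[OF assms(4)]]) (use s in auto)
    show "integral {s..1} (\<lambda>\<sigma>. \<sigma> * \<rho>0 \<sigma>) = p0 s" if "s \<in> {0..<1}" for s
      using that \<rho>0(5)[OF that] assms(1) by (simp add: p0_def assms(6))
  qed (use s in auto)

  have velocity: "continuous_on (closure (spacetime A)) (\<lambda>(t, x). u t x)"
    "C1_on (spacetime A) (\<lambda>(t, x). u t x)"
    using velocity_cont C1_on_velocity by (simp_all add: u_eq case_prod_unfold)
  have powr'_cont: "continuous_on UNIV (\<lambda>t. a * trace (M t) * det (A t) powr a)" for a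
    unfolding trace_def by (intro continuous_intros det_powr_cont M_cont)
  have density: "continuous_on (closure (spacetime A)) (\<lambda>(t, x). \<rho> t x)"
    "C1_on (spacetime A) (\<lambda>(t, x). \<rho> t x)"
    unfolding \<rho>_eq case_prod_unfold
    by (rule transported_cont[OF \<rho>0(1) det_powr_cont])
       (rule C1_on_transported[OF \<rho>0(2,4) det_powr_deriv \<rho>0(3) powr'_cont])
  have energy: "continuous_on (closure (spacetime A)) (\<lambda>(t, x). \<epsilon> t x)"
    "C1_on (spacetime A) (\<lambda>(t, x). \<epsilon> t x)"
    unfolding \<epsilon>_eq case_prod_unfold
    by (rule transported_cont[OF \<epsilon>0'(1) det_powr_cont])
       (rule C1_on_transported[OF \<epsilon>0'(2,4) det_powr_deriv \<epsilon>0'(3) powr'_cont])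

  have euler: "euler_equations_on (spacetime A) \<gamma> u \<rho> \<epsilon> p"
    unfolding euler_equations_on_def
  proof (clarify, intro conjI)
    fix t x assume z: "(t, x) \<in> spacetime A"
    have "material_deriv u \<rho> t x =
        (- 1) * trace (M t) * det (A t) powr (- 1) * \<rho>0 (norm (B t *v x))"
      unfolding u_eq \<rho>_eq by (rule material_deriv_transported[OF \<rho>0(2,4) det_powr_deriv z])
    then show "material_deriv u \<rho> t x + \<rho> t x * divergence u t x = 0"
      unfolding u_eq divergence_velocity by (simp add: \<rho>_eq)
    have "material_deriv u \<epsilon> t x =
        (- (\<gamma> - 1)) * trace (M t) * det (A t) powr (- (\<gamma> - 1)) * \<epsilon>0 (norm (B t *v x))"
      unfolding u_eq \<epsilon>_eq by (rule material_deriv_transported[OF \<epsilon>0'(2,4) det_powr_deriv z])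
    then show "material_deriv u \<epsilon> t x + (\<gamma> - 1) * \<epsilon> t x * divergence u t x = 0"
      unfolding u_eq divergence_velocity by (simp add: \<epsilon>_eq algebra_simps)
    show "p t x = (\<gamma> - 1) * \<rho> t x * \<epsilon> t x" by (rule assms(11))
    \<comment> \<open>The radius in the slope of the pressure profile turns the direction of the label into the label.\<close>
    have "norm (B t *v x) *\<^sub>R sgn (B t *v x) = B t *v x"
      by (cases "B t *v x = 0") (simp_all add: sgn_div_norm)
    then have "norm (B t *v x) *\<^sub>R (sgn (B t *v x) v* B t) = (B t *v x) v* B t"
      by (metis scaleR_vector_matrix_assoc)
    moreover have "grad p t x = (det (A t) powr (- \<gamma>) * - (norm (B t *v x) * \<rho>0 (norm (B t *v x))))
        *\<^sub>R (sgn (B t *v x) v* B t)"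
      unfolding p_eq by (rule grad_transported[OF p0 _ det_powr_deriv z]) auto
    ultimately have "grad p t x =
        - (det (A t) powr (- \<gamma>) * \<rho>0 (norm (B t *v x))) *\<^sub>R ((B t *v x) v* B t)"
      by (metis (no_types, opaque_lifting) mult.commute mult.left_commute mult_minus_left mult_minus_right scaleR_scaleR)
    moreover have "material_deriv u u t x = det (A t) powr (1 - \<gamma>) *\<^sub>R ((B t *v x) v* B t)"
      unfolding u_eq material_deriv_velocity ode
      by (simp add: scaleR_matrix_vector_assoc[symmetric] flip: matrix_vector_mul_assoc)
    moreover have "det (A t) powr (- \<gamma>) = det (A t) powr (- 1) * det (A t) powr (1 - \<gamma>)"
      by (subst powr_add[symmetric]) simp
    ultimately show "\<rho> t x *\<^sub>R material_deriv u u t x + grad p t x = 0"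
      by (simp add: \<rho>_eq algebra_simps)
  qed

  have boundary: "(\<forall>\<eta>. is_normal (lateral_boundary A) (t, x) \<eta> \<longrightarrow> \<eta> \<bullet> (1, u t x) = 0) \<and>
       p t x = 0 \<and> (\<exists>d<0. has_normal_derivative (\<epsilon> t) d (domain_at A t) x)"
    if z: "(t, x) \<in> lateral_boundary A" for t x
  proof (intro conjI allI impI)
    have x: "norm (B t *v x) = 1"
      using z by (simp add: lateral_boundary_eq)
    show "\<eta> \<bullet> (1, u t x) = 0" if "is_normal (lateral_boundary A) (t, x) \<eta>" for \<eta>
      using that flow_tangent[OF z] by (auto simp: is_normal_def u_eq)
    show "p t x = 0"
      by (simp add: p_eq p0_def x assms(7))
    let ?d = "- (1 / ((\<gamma> - 1) * (\<delta> + 1)) * norm ((B t *v x) v* B t) / det (A t) powr (\<gamma> - 1))"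
    have "(B t *v x) v* B t \<noteq> 0"
      using is_normal_ellipsoid_conormal[OF det_nonzero[of t]] x
      by (auto simp: is_normal_def B_def)
    then have "?d < 0"
      using assms(1) \<delta> det_pos[of t] by simp
    moreover have "\<epsilon> t = (\<lambda>x. \<epsilon>0 (norm (matrix_inv (A t) *v x)) / det (A t) powr (\<gamma> - 1))"
      by (rule ext) (rule assms(10))
    then have "has_normal_derivative (\<epsilon> t) ?d (domain_at A t) x"
      unfolding domain_at_def B_def
      using has_normal_derivative_ellipsoid[OF det_nonzero[of t] x[unfolded B_def] assms(7) slope]
      by simp
    ultimately show "\<exists>d<0. has_normal_derivative (\<epsilon> t) d (domain_at A t) x"
      by blast
  qed
  show ?thesis
    using \<epsilon>0 velocity density energy euler boundary by blast
qed

end
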